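(* Let $\alpha_0>0$ and $\beta>\alpha_0$. The solution, homogeneous of degree $1$ in $(x_1,x_2)$, of the differential equation $$(\mathscr A-\delta)G(x_1,x_2;\beta)=0\quad\text{for } x_1,x_2>0,\ \alpha_0\le \frac{x_1}{x_2}\le\beta,$$ with boundary conditions (for all $x_2>0$) $$G(\alpha_0x_2,x_2;\beta)=0,\qquad \frac{\partial}{\partial x_1}G(x_1,x_2;\beta)\Big|_{x_1=\beta x_2-}=1,$$ is given by $$G(x_1,x_2;\beta)=\alpha_0x_2\,\frac{\left(\frac{x_1/x_2}{\alpha_0}\right)^{\zeta_1}-\left(\frac{x_1/x_2}{\alpha_0}\right)^{\zeta_2}}{\zeta_1\left(\frac{\beta}{\alpha_0}\right)^{\zeta_1-1}-\zeta_2\left(\frac{\beta}{\alpha_0}\right)^{\zeta_2-1}},$$ where $\tilde\sigma^2=\sigma_A^2+\sigma_L^2-2\rho\sigma_A\sigma_L$ and $$\zeta_1=\frac{\frac12\tilde\sigma^2-(\mu_A-\mu_L)-\sqrt{\frac14\tilde\sigma^4+(\mu_A-\mu_L)^2-\tilde\sigma^2(\mu_A+\mu_L-2\delta)}}{\tilde\sigma^2}<0,$$ $$\zeta_2=\frac{\frac12\tilde\sigma^2-(\mu_A-\mu_L)+\sqrt{\frac14\tilde\sigma^4+(\mu_A-\mu_L)^2-\tilde\sigma^2(\mu_A+\mu_L-2\delta)}}{\tilde\sigma^2}>1.$$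
   Context: $\mu_A,\mu_L,\delta\in\mathbb R$, $\sigma_A>0$, $\sigma_L>0$, $\rho\in(-1,1)$ are constants with $\delta>\mu_A>\mu_L$ and $\delta>0$. The operator $\mathscr A$ is $$\mathscr Af=\mu_Ax_1\frac{\partial f}{\partial x_1}+\mu_Lx_2\frac{\partial f}{\partial x_2}+\frac12\sigma_A^2x_1^2\frac{\partial^2f}{\partial x_1^2}+\frac12\sigma_L^2x_2^2\frac{\partial^2f}{\partial x_2^2}+\rho\sigma_A\sigma_Lx_1x_2\frac{\partial^2f}{\partial x_1\partial x_2}.$$ Solutions are twice continuously differentiable. Homogeneous of degree $1$ means $G(cx_1,cx_2;\beta)=c\,G(x_1,x_2;\beta)$ for all $c>0$. *)

theory Defs
  imports "HOL-Analysis.Analysis"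
begin

text \<open>
  Partial derivatives are taken relative to a region \<open>S\<close> of the plane, along the
  horizontal and vertical slices of \<open>S\<close>.  At an interior point they are the usual
  partial derivatives; at a boundary point of the closed wedge below they are the
  one-sided ones.  They do not depend on the values of the function outside \<open>S\<close>.
\<close>

definition partial1 :: "(real \<times> real) set \<Rightarrow> (real \<times> real \<Rightarrow> real) \<Rightarrow> real \<times> real \<Rightarrow> real" where
  "partial1 S f = (\<lambda>(x1, x2). vector_derivative (\<lambda>t. f (t, x2)) (at x1 within {t. (t, x2) \<in> S}))"

definition partial2 :: "(real \<times> real) set \<Rightarrow> (real \<times> real \<Rightarrow> real) \<Rightarrow> real \<times> real \<Rightarrow> real" where
  "partial2 S f = (\<lambda>(x1, x2). vector_derivative (\<lambda>t. f (x1, t)) (at x2 within {t. (x1, t) \<in> S}))"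

definition C1_on :: "(real \<times> real) set \<Rightarrow> (real \<times> real \<Rightarrow> real) \<Rightarrow> bool" where
  "C1_on S f \<longleftrightarrow>
     (\<forall>(x1, x2) \<in> S.
        (\<lambda>t. f (t, x2)) differentiable (at x1 within {t. (t, x2) \<in> S}) \<and>
        (\<lambda>t. f (x1, t)) differentiable (at x2 within {t. (x1, t) \<in> S})) \<and>
     continuous_on S f \<and> continuous_on S (partial1 S f) \<and> continuous_on S (partial2 S f)"

definition C2_on :: "(real \<times> real) set \<Rightarrow> (real \<times> real \<Rightarrow> real) \<Rightarrow> bool" where
  "C2_on S f \<longleftrightarrow> C1_on S f \<and> C1_on S (partial1 S f) \<and> C1_on S (partial2 S f)"

definition wedge :: "real \<Rightarrow> real \<Rightarrow> (real \<times> real) set" where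
  "wedge \<alpha>\<^sub>0 \<beta> = {(x1, x2). x1 > 0 \<and> x2 > 0 \<and> \<alpha>\<^sub>0 \<le> x1 / x2 \<and> x1 / x2 \<le> \<beta>}"

definition generator ::
  "real \<Rightarrow> real \<Rightarrow> real \<Rightarrow> real \<Rightarrow> real \<Rightarrow> (real \<times> real) set \<Rightarrow> (real \<times> real \<Rightarrow> real) \<Rightarrow> real \<times> real \<Rightarrow> real"
where
  "generator \<mu>\<^sub>A \<mu>\<^sub>L \<sigma>\<^sub>A \<sigma>\<^sub>L \<rho> S f = (\<lambda>(x1, x2).
       \<mu>\<^sub>A * x1 * partial1 S f (x1, x2)
     + \<mu>\<^sub>L * x2 * partial2 S f (x1, x2)
     + 1 / 2 * \<sigma>\<^sub>A\<^sup>2 * x1\<^sup>2 * partial1 S (partial1 S f) (x1, x2)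
     + 1 / 2 * \<sigma>\<^sub>L\<^sup>2 * x2\<^sup>2 * partial2 S (partial2 S f) (x1, x2)
     + \<rho> * \<sigma>\<^sub>A * \<sigma>\<^sub>L * x1 * x2 * partial1 S (partial2 S f) (x1, x2))"

definition homogeneous1_on :: "(real \<times> real) set \<Rightarrow> (real \<times> real \<Rightarrow> real) \<Rightarrow> bool" where
  "homogeneous1_on S f \<longleftrightarrow> (\<forall>(x1, x2) \<in> S. \<forall>c>0. f (c * x1, c * x2) = c * f (x1, x2))"

definition is_homogeneous_solution ::
  "real \<Rightarrow> real \<Rightarrow> real \<Rightarrow> real \<Rightarrow> real \<Rightarrow> real \<Rightarrow> real \<Rightarrow> real \<Rightarrow> (real \<times> real \<Rightarrow> real) \<Rightarrow> bool"
where
  "is_homogeneous_solution \<mu>\<^sub>A \<mu>\<^sub>L \<sigma>\<^sub>A \<sigma>\<^sub>L \<rho> \<delta> \<alpha>\<^sub>0 \<beta> G \<longleftrightarrow>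
     C2_on (wedge \<alpha>\<^sub>0 \<beta>) G \<and>
     homogeneous1_on (wedge \<alpha>\<^sub>0 \<beta>) G \<and>
     (\<forall>x \<in> wedge \<alpha>\<^sub>0 \<beta>. generator \<mu>\<^sub>A \<mu>\<^sub>L \<sigma>\<^sub>A \<sigma>\<^sub>L \<rho> (wedge \<alpha>\<^sub>0 \<beta>) G x - \<delta> * G x = 0) \<and>
     (\<forall>x2>0. G (\<alpha>\<^sub>0 * x2, x2) = 0) \<and>
     (\<forall>x2>0. ((\<lambda>x1. G (x1, x2)) has_real_derivative 1) (at_left (\<beta> * x2)))"

definition sigma_tilde2 :: "real \<Rightarrow> real \<Rightarrow> real \<Rightarrow> real" where
  "sigma_tilde2 \<sigma>\<^sub>A \<sigma>\<^sub>L \<rho> = \<sigma>\<^sub>A\<^sup>2 + \<sigma>\<^sub>L\<^sup>2 - 2 * \<rho> * \<sigma>\<^sub>A * \<sigma>\<^sub>L"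

definition zeta1 :: "real \<Rightarrow> real \<Rightarrow> real \<Rightarrow> real \<Rightarrow> real" where
  "zeta1 \<mu>\<^sub>A \<mu>\<^sub>L \<delta> s2 =
     (1 / 2 * s2 - (\<mu>\<^sub>A - \<mu>\<^sub>L)
       - sqrt (1 / 4 * s2\<^sup>2 + (\<mu>\<^sub>A - \<mu>\<^sub>L)\<^sup>2 - s2 * (\<mu>\<^sub>A + \<mu>\<^sub>L - 2 * \<delta>))) / s2"

definition zeta2 :: "real \<Rightarrow> real \<Rightarrow> real \<Rightarrow> real \<Rightarrow> real" where
  "zeta2 \<mu>\<^sub>A \<mu>\<^sub>L \<delta> s2 =
     (1 / 2 * s2 - (\<mu>\<^sub>A - \<mu>\<^sub>L)
       + sqrt (1 / 4 * s2\<^sup>2 + (\<mu>\<^sub>A - \<mu>\<^sub>L)\<^sup>2 - s2 * (\<mu>\<^sub>A + \<mu>\<^sub>L - 2 * \<delta>))) / s2"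

definition candidate :: "real \<Rightarrow> real \<Rightarrow> real \<Rightarrow> real \<Rightarrow> real \<times> real \<Rightarrow> real" where
  "candidate \<zeta>\<^sub>1 \<zeta>\<^sub>2 \<alpha>\<^sub>0 \<beta> = (\<lambda>(x1, x2).
     \<alpha>\<^sub>0 * x2 *
       ((((x1 / x2) / \<alpha>\<^sub>0) powr \<zeta>\<^sub>1 - ((x1 / x2) / \<alpha>\<^sub>0) powr \<zeta>\<^sub>2)
        / (\<zeta>\<^sub>1 * (\<beta> / \<alpha>\<^sub>0) powr (\<zeta>\<^sub>1 - 1) - \<zeta>\<^sub>2 * (\<beta> / \<alpha>\<^sub>0) powr (\<zeta>\<^sub>2 - 1))))"

end

theory Submission
  imports Defs
begin

text \<open>
  Homogeneity of degree \<open>1\<close> turns the partial differential equation into an ordinary one.  A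
  homogeneous function is \<open>G (x1, x2) = x2 * g (x1 / x2)\<close> for its profile \<open>g\<close>, and with
  \<open>y = x1 / x2\<close> its derivatives are \<open>g'\<close>, \<open>g - y g'\<close> and, in second order,
  \<open>g'' / x2\<close>, \<open>- y g'' / x2\<close>, \<open>y\<^sup>2 g'' / x2\<close>.  The three second derivatives are multiples of the
  same \<open>g''\<close>, so the volatilities and the correlation enter only through the combination
  \<open>s2 = sigma_tilde2\<close>, and the equation \<open>(A - \<delta>) G = 0\<close> becomes the Euler equation
  \<open>1/2 s2 y\<^sup>2 g'' + (\<mu>\<^sub>A - \<mu>\<^sub>L) y g' + (\<mu>\<^sub>L - \<delta>) g = 0\<close> on \<open>[\<alpha>\<^sub>0, \<beta>]\<close>
  (lemma \<open>generator_degree1_profile\<close>).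

  The characteristic polynomial of this equation takes the negative values \<open>\<mu>\<^sub>L - \<delta>\<close> at \<open>0\<close> and
  \<open>\<mu>\<^sub>A - \<delta>\<close> at \<open>1\<close>.  Its roots \<open>\<zeta>\<^sub>1\<close> and \<open>\<zeta>\<^sub>2\<close> therefore satisfy \<open>\<zeta>\<^sub>1 < 0\<close> and \<open>\<zeta>\<^sub>2 > 1\<close>
  (lemma \<open>characteristic_roots\<close>).  Writing \<open>D = y d/dy\<close>, the equation factors as
  \<open>(D - \<zeta>\<^sub>1) (D - \<zeta>\<^sub>2) g = 0\<close> with commuting factors, so \<open>(D - \<zeta>\<^sub>1) g\<close> is a multiple of \<open>y powr \<zeta>\<^sub>2\<close>
  and \<open>(D - \<zeta>\<^sub>2) g\<close> is a multiple of \<open>y powr \<zeta>\<^sub>1\<close>.  Since \<open>\<zeta>\<^sub>1 \<noteq> \<zeta>\<^sub>2\<close>, both \<open>g\<close> and \<open>y g'\<close> are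
  linear combinations of these two expressions (lemma \<open>euler_solution\<close>).  The condition
  \<open>g \<alpha>\<^sub>0 = 0\<close> leaves the single parameter \<open>g' \<alpha>\<^sub>0\<close>, and \<open>g' \<beta> = 1\<close> determines it because
  \<open>\<zeta>\<^sub>1 < 0 < \<zeta>\<^sub>2\<close> makes the denominator of the candidate negative.  Conversely, the
  profile found in this way is a combination of two powers, hence smooth on \<open>[\<alpha>\<^sub>0, \<beta>]\<close>, and the same
  correspondence turns it into a twice continuously differentiable solution on the closed wedge.
\<close>

section \<open>Homogeneous functions on the wedge and their profiles\<close>

lemma mem_wedge_iff: "(x1, x2) \<in> wedge \<alpha> \<beta> \<longleftrightarrow> x1 > 0 \<and> x2 > 0 \<and> x1 / x2 \<in> {\<alpha>..\<beta>}"
  by (auto simp: wedge_def)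

lemma horizontal_slice_wedge:
  assumes "0 < \<alpha>" "0 < x2"
  shows "{t. (t, x2) \<in> wedge \<alpha> \<beta>} = {\<alpha> * x2..\<beta> * x2}"
proof -
  have "0 < \<alpha> * x2" using assms by simp
  then have "0 < t" if "\<alpha> * x2 \<le> t" for t using that by linarith
  then show ?thesis
    using assms by (auto simp: mem_wedge_iff field_simps)
qed

lemma vertical_slice_wedge:
  assumes "0 < \<alpha>" "\<alpha> < \<beta>" "0 < x1"
  shows "{t. (x1, t) \<in> wedge \<alpha> \<beta>} = {x1 / \<beta>..x1 / \<alpha>}"
proof -
  have "0 < x1 / \<beta>" using assms by simp
  then have "0 < t" if "x1 / \<beta> \<le> t" for t using that by linarith
  then show ?thesis
    using assms by (auto simp: mem_wedge_iff field_simps)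
qed

text \<open>
  The slices of the wedge are closed intervals, and the assumption \<open>\<alpha> < \<beta>\<close> makes them nondegenerate.
  Hence one-sided derivatives at their ends are unique, and the choice operator inside
  \<^const>\<open>vector_derivative\<close> returns the expected value.
\<close>
lemma partial1_eqI:
  assumes "0 < \<alpha>" "\<alpha> < \<beta>" "(x1, x2) \<in> wedge \<alpha> \<beta>"
    and "((\<lambda>t. f (t, x2)) has_real_derivative d) (at x1 within {t. (t, x2) \<in> wedge \<alpha> \<beta>})"
  shows "partial1 (wedge \<alpha> \<beta>) f (x1, x2) = d"
proof -
  have x: "0 < x2" "x1 \<in> {t. (t, x2) \<in> wedge \<alpha> \<beta>}"
    using assms(3) by (auto simp: mem_wedge_iff)
  then show ?thesis
    using assms horizontal_slice_wedge[of \<alpha> x2 \<beta>]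
    by (auto simp: partial1_def has_real_derivative_iff_has_vector_derivative
        intro!: vector_derivative_within_closed_interval)
qed

lemma partial2_eqI:
  assumes "0 < \<alpha>" "\<alpha> < \<beta>" "(x1, x2) \<in> wedge \<alpha> \<beta>"
    and "((\<lambda>t. f (x1, t)) has_real_derivative d) (at x2 within {t. (x1, t) \<in> wedge \<alpha> \<beta>})"
  shows "partial2 (wedge \<alpha> \<beta>) f (x1, x2) = d"
proof -
  have x: "0 < x1" "x2 \<in> {t. (x1, t) \<in> wedge \<alpha> \<beta>}"
    using assms(3) by (auto simp: mem_wedge_iff)
  moreover have "x1 / \<beta> < x1 / \<alpha>"
    using assms x by (simp add: frac_less2)
  ultimately show ?thesis
    using assms vertical_slice_wedge[of \<alpha> \<beta> x1]
    by (auto simp: partial2_def has_real_derivative_iff_has_vector_derivative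
        intro!: vector_derivative_within_closed_interval)
qed

text \<open>
  The degree is an integer because differentiation lowers it: the second derivatives of a
  function homogeneous of degree \<open>1\<close> have degree \<open>-1\<close>.  Keeping it as a parameter lets the same
  lemmas serve the function and all its partial derivatives.
\<close>
definition has_profile ::
  "real \<Rightarrow> real \<Rightarrow> int \<Rightarrow> (real \<Rightarrow> real) \<Rightarrow> (real \<times> real \<Rightarrow> real) \<Rightarrow> bool" where
  "has_profile \<alpha> \<beta> n g f \<longleftrightarrow>
     (\<forall>(x1, x2) \<in> wedge \<alpha> \<beta>. f (x1, x2) = x2 powi n * g (x1 / x2))"

lemma has_profileD:
  "has_profile \<alpha> \<beta> n g f \<Longrightarrow> (x1, x2) \<in> wedge \<alpha> \<beta> \<Longrightarrow> f (x1, x2) = x2 powi n * g (x1 / x2)"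
  by (auto simp: has_profile_def)

context
  fixes \<alpha> \<beta> :: real and n :: int and f :: "real \<times> real \<Rightarrow> real" and g g' :: "real \<Rightarrow> real"
  assumes bounds: "0 < \<alpha>" "\<alpha> < \<beta>"
    and prof: "has_profile \<alpha> \<beta> n g f"
    and deriv: "\<And>y. y \<in> {\<alpha>..\<beta>} \<Longrightarrow> (g has_real_derivative g' y) (at y within {\<alpha>..\<beta>})"
begin

lemma has_profile_horizontal_derivative:
  assumes x: "(x1, x2) \<in> wedge \<alpha> \<beta>"
  shows "((\<lambda>t. f (t, x2)) has_real_derivative x2 powi (n - 1) * g' (x1 / x2))
           (at x1 within {t. (t, x2) \<in> wedge \<alpha> \<beta>})" (is "(_ has_real_derivative _) (at x1 within ?S)")
proof -
  have pos: "x2 > 0" and y: "x1 / x2 \<in> {\<alpha>..\<beta>}" using x by (auto simp: mem_wedge_iff)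
  have "(\<lambda>t. t / x2) ` ?S \<subseteq> {\<alpha>..\<beta>}" by (auto simp: mem_wedge_iff)
  then have g: "(g has_real_derivative g' (x1 / x2)) (at (x1 / x2) within (\<lambda>t. t / x2) ` ?S)"
    using deriv[OF y] DERIV_subset by blast
  have inner: "((\<lambda>t. t / x2) has_real_derivative 1 / x2) (at x1 within ?S)"
    using pos by (auto intro!: derivative_eq_intros)
  have "((\<lambda>t. x2 powi n * g (t / x2)) has_real_derivative x2 powi n * (g' (x1 / x2) * (1 / x2)))
          (at x1 within ?S)"
    using DERIV_cmult[OF DERIV_image_chain[OF g inner]] by (simp add: o_def)
  also have "x2 powi n * (g' (x1 / x2) * (1 / x2)) = x2 powi (n - 1) * g' (x1 / x2)"
    using pos by (simp add: power_int_diff)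
  finally show ?thesis
    by (rule has_field_derivative_transform_within[OF _ zero_less_one])
       (use x has_profileD[OF prof] in auto)
qed

lemma has_profile_vertical_derivative:
  assumes x: "(x1, x2) \<in> wedge \<alpha> \<beta>"
  shows "((\<lambda>t. f (x1, t)) has_real_derivative
            x2 powi (n - 1) * (of_int n * g (x1 / x2) - (x1 / x2) * g' (x1 / x2)))
           (at x2 within {t. (x1, t) \<in> wedge \<alpha> \<beta>})" (is "(_ has_real_derivative _) (at x2 within ?S)")
proof -
  have pos: "x2 > 0" and y: "x1 / x2 \<in> {\<alpha>..\<beta>}" using x by (auto simp: mem_wedge_iff)
  have "(\<lambda>t. x1 / t) ` ?S \<subseteq> {\<alpha>..\<beta>}" by (auto simp: mem_wedge_iff)
  then have g: "(g has_real_derivative g' (x1 / x2)) (at (x1 / x2) within (\<lambda>t. x1 / t) ` ?S)"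
    using deriv[OF y] DERIV_subset by blast
  have inner: "((\<lambda>t. x1 / t) has_real_derivative - x1 / x2\<^sup>2) (at x2 within ?S)"
    using pos by (auto intro!: derivative_eq_intros simp: power2_eq_square)
  have pow: "((\<lambda>t. t powi n) has_real_derivative of_int n * x2 powi (n - 1)) (at x2 within ?S)"
    using pos by (auto intro!: derivative_eq_intros)
  have "((\<lambda>t. t powi n * g (x1 / t)) has_real_derivative
          of_int n * x2 powi (n - 1) * g (x1 / x2) + g' (x1 / x2) * (- x1 / x2\<^sup>2) * x2 powi n)
          (at x2 within ?S)"
    using DERIV_mult[OF pow DERIV_image_chain[OF g inner]] by (simp add: o_def)
  also have "of_int n * x2 powi (n - 1) * g (x1 / x2) + g' (x1 / x2) * (- x1 / x2\<^sup>2) * x2 powi n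
      = x2 powi (n - 1) * (of_int n * g (x1 / x2) - (x1 / x2) * g' (x1 / x2))"
    using pos by (simp add: power_int_diff field_simps power2_eq_square)
  finally show ?thesis
    by (rule has_field_derivative_transform_within[OF _ zero_less_one])
       (use x has_profileD[OF prof] in auto)
qed

lemma has_profile_partial1: "has_profile \<alpha> \<beta> (n - 1) g' (partial1 (wedge \<alpha> \<beta>) f)"
  unfolding has_profile_def
  using bounds partial1_eqI has_profile_horizontal_derivative by blast

lemma has_profile_partial2:
  "has_profile \<alpha> \<beta> (n - 1) (\<lambda>y. of_int n * g y - y * g' y) (partial2 (wedge \<alpha> \<beta>) f)"
  unfolding has_profile_def
  using bounds partial2_eqI has_profile_vertical_derivative by blast

end

lemma continuous_on_has_profile:
  assumes prof: "has_profile \<alpha> \<beta> n g f" and g: "continuous_on {\<alpha>..\<beta>} g"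
  shows "continuous_on (wedge \<alpha> \<beta>) f"
proof -
  have nz: "snd x \<noteq> 0" if "x \<in> wedge \<alpha> \<beta>" for x
    using that by (cases x) (auto simp: mem_wedge_iff)
  have "continuous_on (wedge \<alpha> \<beta>) (\<lambda>x. snd x powi n * g (fst x / snd x))"
    using nz
    by (intro continuous_intros continuous_on_compose2[OF g])
       (auto simp: mem_wedge_iff)
  then show ?thesis
    by (rule continuous_on_eq) (use has_profileD[OF prof] in auto)
qed

lemma C1_on_has_profile:
  assumes bounds: "0 < \<alpha>" "\<alpha> < \<beta>" and prof: "has_profile \<alpha> \<beta> n g f"
    and deriv: "\<And>y. y \<in> {\<alpha>..\<beta>} \<Longrightarrow> (g has_real_derivative g' y) (at y within {\<alpha>..\<beta>})"
    and cont: "continuous_on {\<alpha>..\<beta>} g'"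
  shows "C1_on (wedge \<alpha> \<beta>) f"
proof -
  have g: "continuous_on {\<alpha>..\<beta>} g" using deriv by (rule DERIV_continuous_on)
  note d1 = has_profile_horizontal_derivative[OF bounds prof deriv]
  note d2 = has_profile_vertical_derivative[OF bounds prof deriv]
  have "(\<lambda>t. f (t, x2)) differentiable at x1 within {t. (t, x2) \<in> wedge \<alpha> \<beta>}"
       "(\<lambda>t. f (x1, t)) differentiable at x2 within {t. (x1, t) \<in> wedge \<alpha> \<beta>}"
    if "(x1, x2) \<in> wedge \<alpha> \<beta>" for x1 x2
    using d1[OF _ that] d2[OF _ that] by (auto simp: real_differentiable_def)
  moreover have "continuous_on (wedge \<alpha> \<beta>) f"
    using prof g by (rule continuous_on_has_profile)
  moreover have "continuous_on (wedge \<alpha> \<beta>) (partial1 (wedge \<alpha> \<beta>) f)"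
    using has_profile_partial1[OF bounds prof deriv] cont by (rule continuous_on_has_profile)
  moreover have "continuous_on (wedge \<alpha> \<beta>) (partial2 (wedge \<alpha> \<beta>) f)"
    by (rule continuous_on_has_profile[OF has_profile_partial2[OF bounds prof deriv]])
       (auto intro!: continuous_intros g cont)
  ultimately show ?thesis by (auto simp: C1_on_def)
qed

context
  fixes \<alpha> \<beta> :: real and f :: "real \<times> real \<Rightarrow> real" and g g' g'' :: "real \<Rightarrow> real"
  assumes bounds: "0 < \<alpha>" "\<alpha> < \<beta>"
    and prof: "has_profile \<alpha> \<beta> 1 g f"
    and deriv: "\<And>y. y \<in> {\<alpha>..\<beta>} \<Longrightarrow> (g has_real_derivative g' y) (at y within {\<alpha>..\<beta>})"
    and deriv2: "\<And>y. y \<in> {\<alpha>..\<beta>} \<Longrightarrow> (g' has_real_derivative g'' y) (at y within {\<alpha>..\<beta>})"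
begin

lemma degree1_profile_partial1: "has_profile \<alpha> \<beta> 0 g' (partial1 (wedge \<alpha> \<beta>) f)"
  using has_profile_partial1[OF bounds prof deriv] by simp

lemma degree1_profile_partial2: "has_profile \<alpha> \<beta> 0 (\<lambda>y. g y - y * g' y) (partial2 (wedge \<alpha> \<beta>) f)"
  using has_profile_partial2[OF bounds prof deriv] by simp

lemma degree1_profile_partial2_derivative:
  assumes "y \<in> {\<alpha>..\<beta>}"
  shows "((\<lambda>y. g y - y * g' y) has_real_derivative - y * g'' y) (at y within {\<alpha>..\<beta>})"
  by (auto intro!: derivative_eq_intros deriv[OF assms] deriv2[OF assms])

lemma C2_on_degree1_profile:
  assumes cont: "continuous_on {\<alpha>..\<beta>} g''"
  shows "C2_on (wedge \<alpha> \<beta>) f"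
  unfolding C2_on_def
proof (intro conjI)
  have "continuous_on {\<alpha>..\<beta>} g'" using deriv2 by (rule DERIV_continuous_on)
  then show "C1_on (wedge \<alpha> \<beta>) f"
    using C1_on_has_profile[OF bounds prof deriv] by blast
  show "C1_on (wedge \<alpha> \<beta>) (partial1 (wedge \<alpha> \<beta>) f)"
    by (rule C1_on_has_profile[OF bounds degree1_profile_partial1 deriv2 cont])
  show "C1_on (wedge \<alpha> \<beta>) (partial2 (wedge \<alpha> \<beta>) f)"
    by (rule C1_on_has_profile[OF bounds degree1_profile_partial2 degree1_profile_partial2_derivative])
       (auto intro!: continuous_intros cont)
qed

text \<open>
  All second derivatives are multiples of \<open>g''\<close>, so their coefficients collect into \<open>\<sigma>\<^sub>A\<^sup>2\<close>, \<open>\<sigma>\<^sub>L\<^sup>2\<close>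
  and \<open>- 2 \<rho> \<sigma>\<^sub>A \<sigma>\<^sub>L\<close>; the minus sign is that of the mixed derivative \<open>- y g'' / x2\<close>.  The term
  \<open>\<mu>\<^sub>L g\<close> and the subtraction in \<open>\<mu>\<^sub>A - \<mu>\<^sub>L\<close> come from the derivative \<open>g - y g'\<close> in \<open>x2\<close>.
\<close>
lemma generator_degree1_profile:
  assumes x: "(x1, x2) \<in> wedge \<alpha> \<beta>" and y: "y = x1 / x2"
  shows "generator \<mu>\<^sub>A \<mu>\<^sub>L \<sigma>\<^sub>A \<sigma>\<^sub>L \<rho> (wedge \<alpha> \<beta>) f (x1, x2)
       = x2 * (1 / 2 * sigma_tilde2 \<sigma>\<^sub>A \<sigma>\<^sub>L \<rho> * y\<^sup>2 * g'' y + (\<mu>\<^sub>A - \<mu>\<^sub>L) * y * g' y + \<mu>\<^sub>L * g y)"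
proof -
  let ?S = "wedge \<alpha> \<beta>"
  have pos: "x2 > 0" using x by (simp add: mem_wedge_iff)
  have x1: "x1 = y * x2" using pos y by simp
  have "partial1 ?S f (x1, x2) = g' y"
    using has_profileD[OF degree1_profile_partial1 x] y by simp
  moreover have "partial2 ?S f (x1, x2) = g y - y * g' y"
    using has_profileD[OF degree1_profile_partial2 x] y by simp
  moreover have "partial1 ?S (partial1 ?S f) (x1, x2) = g'' y / x2"
    using has_profileD[OF has_profile_partial1[OF bounds degree1_profile_partial1 deriv2] x] y
    by (simp add: power_int_minus divide_inverse)
  moreover have "partial1 ?S (partial2 ?S f) (x1, x2) = - y * g'' y / x2"
    using has_profileD[OF has_profile_partial1[OF bounds degree1_profile_partial2
          degree1_profile_partial2_derivative] x] y
    by (simp add: power_int_minus divide_inverse)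
  moreover have "partial2 ?S (partial2 ?S f) (x1, x2) = y\<^sup>2 * g'' y / x2"
    using has_profileD[OF has_profile_partial2[OF bounds degree1_profile_partial2
          degree1_profile_partial2_derivative] x] y
    by (simp add: power_int_minus divide_inverse power2_eq_square)
  ultimately have "generator \<mu>\<^sub>A \<mu>\<^sub>L \<sigma>\<^sub>A \<sigma>\<^sub>L \<rho> ?S f (x1, x2)
      = \<mu>\<^sub>A * x1 * g' y + \<mu>\<^sub>L * x2 * (g y - y * g' y)
        + 1 / 2 * \<sigma>\<^sub>A\<^sup>2 * x1\<^sup>2 * (g'' y / x2) + 1 / 2 * \<sigma>\<^sub>L\<^sup>2 * x2\<^sup>2 * (y\<^sup>2 * g'' y / x2)
        + \<rho> * \<sigma>\<^sub>A * \<sigma>\<^sub>L * x1 * x2 * (- y * g'' y / x2)"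
    by (simp add: generator_def)
  then show ?thesis
    using pos unfolding x1 sigma_tilde2_def by (simp add: field_simps power2_eq_square)
qed

end

text \<open>
  The profile is the restriction \<open>t \<mapsto> G (t, 1)\<close> to the slice at height \<open>1\<close>, which is the interval
  \<open>[\<alpha>, \<beta>]\<close> itself; homogeneity recovers \<open>G\<close> from it.  The derivatives of the profile are the
  horizontal derivatives of \<open>G\<close> along this slice.
\<close>
lemma C2_homogeneous_has_profile:
  assumes bounds: "0 < \<alpha>" "\<alpha> < \<beta>"
    and C2: "C2_on (wedge \<alpha> \<beta>) G" and hom: "homogeneous1_on (wedge \<alpha> \<beta>) G"
  obtains g g' g'' where "has_profile \<alpha> \<beta> 1 g G"
    and "\<And>y. y \<in> {\<alpha>..\<beta>} \<Longrightarrow> (g has_real_derivative g' y) (at y within {\<alpha>..\<beta>})"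
    and "\<And>y. y \<in> {\<alpha>..\<beta>} \<Longrightarrow> (g' has_real_derivative g'' y) (at y within {\<alpha>..\<beta>})"
proof
  let ?S = "wedge \<alpha> \<beta>"
  have slice: "{t. (t, 1) \<in> ?S} = {\<alpha>..\<beta>}"
    using horizontal_slice_wedge[of \<alpha> 1 \<beta>] bounds by simp
  have deriv: "((\<lambda>t. f (t, 1)) has_real_derivative partial1 ?S f (y, 1)) (at y within {\<alpha>..\<beta>})"
    if "C1_on ?S f" "y \<in> {\<alpha>..\<beta>}" for f y
  proof -
    have "(y, 1) \<in> ?S" using that slice by blast
    then have "(\<lambda>t. f (t, 1)) differentiable at y within {\<alpha>..\<beta>}"
      using that(1) slice by (fastforce simp: C1_on_def)
    then show ?thesis
      by (simp add: vector_derivative_works has_real_derivative_iff_has_vector_derivative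
          partial1_def slice)
  qed
  have "C1_on ?S G" "C1_on ?S (partial1 ?S G)" using C2 by (auto simp: C2_on_def)
  then show "((\<lambda>t. G (t, 1)) has_real_derivative partial1 ?S G (y, 1)) (at y within {\<alpha>..\<beta>})"
    and "((\<lambda>t. partial1 ?S G (t, 1)) has_real_derivative partial1 ?S (partial1 ?S G) (y, 1))
          (at y within {\<alpha>..\<beta>})" if "y \<in> {\<alpha>..\<beta>}" for y
    using deriv that by blast+
  show "has_profile \<alpha> \<beta> 1 (\<lambda>t. G (t, 1)) G"
    unfolding has_profile_def
  proof clarify
    fix x1 x2 assume x: "(x1, x2) \<in> ?S"
    then have pos: "x2 > 0" and "(x1 / x2, 1) \<in> ?S" by (auto simp: mem_wedge_iff)
    then have "G (x2 * (x1 / x2), x2 * 1) = x2 * G (x1 / x2, 1)"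
      using hom unfolding homogeneous1_on_def by blast
    then show "G (x1, x2) = x2 powi 1 * G (x1 / x2, 1)" using pos by simp
  qed
qed

section \<open>The Euler equation of the profile\<close>

text \<open>
  The product of the roots and the product \<open>(1 - \<zeta>\<^sub>1) (1 - \<zeta>\<^sub>2)\<close> are, up to a positive factor, the values
  \<open>\<mu>\<^sub>L - \<delta>\<close> and \<open>\<mu>\<^sub>A - \<delta>\<close> of the characteristic polynomial at \<open>0\<close> and \<open>1\<close>.  Both are
  negative, so \<open>0\<close> and \<open>1\<close> lie strictly between the roots.  Vieta's formulas are part of the
  statement because they are what rewrites the Euler equation in terms of its roots.
\<close>
lemma characteristic_roots:
  fixes s2 :: real
  assumes s2: "s2 > 0" and "\<mu>\<^sub>A < \<delta>" "\<mu>\<^sub>L < \<delta>"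
  shows "zeta1 \<mu>\<^sub>A \<mu>\<^sub>L \<delta> s2 < 0" and "zeta2 \<mu>\<^sub>A \<mu>\<^sub>L \<delta> s2 > 1"
    and "s2 * (zeta1 \<mu>\<^sub>A \<mu>\<^sub>L \<delta> s2 + zeta2 \<mu>\<^sub>A \<mu>\<^sub>L \<delta> s2) = s2 - 2 * (\<mu>\<^sub>A - \<mu>\<^sub>L)"
    and "s2 * (zeta1 \<mu>\<^sub>A \<mu>\<^sub>L \<delta> s2 * zeta2 \<mu>\<^sub>A \<mu>\<^sub>L \<delta> s2) = 2 * (\<mu>\<^sub>L - \<delta>)"
proof -
  define b where "b = 1 / 2 * s2 - (\<mu>\<^sub>A - \<mu>\<^sub>L)"
  define D where "D = 1 / 4 * s2\<^sup>2 + (\<mu>\<^sub>A - \<mu>\<^sub>L)\<^sup>2 - s2 * (\<mu>\<^sub>A + \<mu>\<^sub>L - 2 * \<delta>)"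
  define z1 where "z1 = zeta1 \<mu>\<^sub>A \<mu>\<^sub>L \<delta> s2"
  define z2 where "z2 = zeta2 \<mu>\<^sub>A \<mu>\<^sub>L \<delta> s2"
  have z: "z1 = (b - sqrt D) / s2" "z2 = (b + sqrt D) / s2"
    by (simp_all add: z1_def z2_def zeta1_def zeta2_def b_def D_def)
  have D: "D = b\<^sup>2 + 2 * s2 * (\<delta> - \<mu>\<^sub>L)"
    by (simp add: D_def b_def power2_eq_square algebra_simps)
  then have D0: "D > 0"
    using assms by (smt (verit) mult_pos_pos zero_le_power2)
  have sum: "s2 * (z1 + z2) = s2 - 2 * (\<mu>\<^sub>A - \<mu>\<^sub>L)"
    using s2 by (simp add: z b_def field_simps)
  have "s2 * (z1 * z2) = (b\<^sup>2 - (sqrt D)\<^sup>2) / s2"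
    using s2 by (simp add: z power2_eq_square field_simps)
  also have "\<dots> = 2 * (\<mu>\<^sub>L - \<delta>)"
    using s2 D0 D by (simp add: field_simps)
  finally have prod: "s2 * (z1 * z2) = 2 * (\<mu>\<^sub>L - \<delta>)" .
  have less: "z1 < z2" using s2 D0 by (simp add: z divide_strict_right_mono)
  have "s2 * (z1 * z2) < 0" using prod assms by simp
  then have neg: "z1 * z2 < 0" using s2 by (simp add: mult_less_0_iff)
  then have z1_neg: "z1 < 0" using less by (auto simp: mult_less_0_iff)
  have "s2 * ((1 - z1) * (1 - z2)) = 2 * (\<mu>\<^sub>A - \<delta>)"
    using sum prod by (simp add: algebra_simps)
  then have "s2 * ((1 - z1) * (1 - z2)) < 0" using assms by simp
  then have "(1 - z1) * (1 - z2) < 0" using s2 by (simp add: mult_less_0_iff)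
  then have z2_gt: "z2 > 1" using z1_neg by (auto simp: mult_less_0_iff)
  show "zeta1 \<mu>\<^sub>A \<mu>\<^sub>L \<delta> s2 < 0" "zeta2 \<mu>\<^sub>A \<mu>\<^sub>L \<delta> s2 > 1"
    "s2 * (zeta1 \<mu>\<^sub>A \<mu>\<^sub>L \<delta> s2 + zeta2 \<mu>\<^sub>A \<mu>\<^sub>L \<delta> s2) = s2 - 2 * (\<mu>\<^sub>A - \<mu>\<^sub>L)"
    "s2 * (zeta1 \<mu>\<^sub>A \<mu>\<^sub>L \<delta> s2 * zeta2 \<mu>\<^sub>A \<mu>\<^sub>L \<delta> s2) = 2 * (\<mu>\<^sub>L - \<delta>)"
    using z1_neg z2_gt sum prod by (simp_all add: z1_def z2_def)
qed

text \<open>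
  The integrating factor \<open>y powr (- z)\<close> turns \<open>y u' = z u\<close> into the vanishing of a derivative.
\<close>
lemma first_order_euler_solution:
  fixes u :: "real \<Rightarrow> real"
  assumes "0 < \<alpha>" "y \<in> {\<alpha>..\<beta>}"
    and u: "\<And>y. y \<in> {\<alpha>..\<beta>} \<Longrightarrow> (u has_real_derivative z * u y / y) (at y within {\<alpha>..\<beta>})"
  shows "u y = u \<alpha> * (y / \<alpha>) powr z"
proof -
  have "((\<lambda>y. u y * y powr (- z)) has_real_derivative 0) (at y within {\<alpha>..\<beta>})"
    if y: "y \<in> {\<alpha>..\<beta>}" for y
  proof -
    have pos: "y > 0" using y assms(1) by auto
    have "((\<lambda>y. y powr (- z)) has_real_derivative - z * y powr (- z - 1)) (at y within {\<alpha>..\<beta>})"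
      using has_real_derivative_powr[OF pos, of "- z"] by (simp add: has_field_derivative_at_within)
    from DERIV_mult[OF u[OF y] this]
    have "((\<lambda>y. u y * y powr (- z)) has_real_derivative
            z * u y / y * y powr (- z) + - z * y powr (- z - 1) * u y) (at y within {\<alpha>..\<beta>})" .
    also have "z * u y / y * y powr (- z) + - z * y powr (- z - 1) * u y = 0"
      using pos by (simp add: powr_diff)
    finally show ?thesis .
  qed
  then obtain c where c: "\<And>y. y \<in> {\<alpha>..\<beta>} \<Longrightarrow> u y * y powr (- z) = c"
    using has_field_derivative_zero_constant[of "{\<alpha>..\<beta>}" "\<lambda>y. u y * y powr (- z)"] by auto
  have "u y * y powr (- z) = u \<alpha> * \<alpha> powr (- z)"
    using c[of y] c[of \<alpha>] assms(2) by auto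
  then show ?thesis
    using assms by (simp add: powr_minus powr_divide field_simps)
qed

text \<open>
  With \<open>D = y d/dy\<close> the equation reads \<open>(D - z1) (D - z2) g = 0\<close>.  The factors commute, so each
  of \<open>(D - z1) g\<close> and \<open>(D - z2) g\<close> solves a first-order equation, and \<open>g\<close> and \<open>D g\<close> are
  linear combinations of the two.  Because \<open>g \<alpha> = 0\<close>, both first-order solutions start at the same value
  \<open>\<alpha> * g' \<alpha>\<close>.
\<close>
lemma euler_solution:
  fixes g g' g'' :: "real \<Rightarrow> real"
  assumes "0 < \<alpha>" "z1 \<noteq> z2" "y \<in> {\<alpha>..\<beta>}"
    and deriv: "\<And>y. y \<in> {\<alpha>..\<beta>} \<Longrightarrow> (g has_real_derivative g' y) (at y within {\<alpha>..\<beta>})"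
    and deriv2: "\<And>y. y \<in> {\<alpha>..\<beta>} \<Longrightarrow> (g' has_real_derivative g'' y) (at y within {\<alpha>..\<beta>})"
    and ode: "\<And>y. y \<in> {\<alpha>..\<beta>} \<Longrightarrow> y\<^sup>2 * g'' y + (1 - z1 - z2) * y * g' y + z1 * z2 * g y = 0"
    and init: "g \<alpha> = 0"
  shows "(z1 - z2) * g y = \<alpha> * g' \<alpha> * ((y / \<alpha>) powr z1 - (y / \<alpha>) powr z2)"
    and "(z1 - z2) * g' y = g' \<alpha> * (z1 * (y / \<alpha>) powr (z1 - 1) - z2 * (y / \<alpha>) powr (z2 - 1))"
proof -
  (* Stated for either order of the roots: the equation is symmetric in them. *)
  have factor: "y * g' y - w1 * g y = \<alpha> * g' \<alpha> * (y / \<alpha>) powr w2"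
    if w: "\<And>y. y \<in> {\<alpha>..\<beta>} \<Longrightarrow> y\<^sup>2 * g'' y + (1 - w1 - w2) * y * g' y + w1 * w2 * g y = 0"
    for w1 w2
  proof -
    have "((\<lambda>y. y * g' y - w1 * g y) has_real_derivative w2 * (y * g' y - w1 * g y) / y)
            (at y within {\<alpha>..\<beta>})" if y: "y \<in> {\<alpha>..\<beta>}" for y
    proof -
      have pos: "y > 0" using y assms(1) by auto
      have "((\<lambda>y. y * g' y - w1 * g y) has_real_derivative g' y + y * g'' y - w1 * g' y)
            (at y within {\<alpha>..\<beta>})"
        by (auto intro!: derivative_eq_intros deriv[OF y] deriv2[OF y])
      also have "g' y + y * g'' y - w1 * g' y = w2 * (y * g' y - w1 * g y) / y"
        using w[OF y] pos by (simp add: field_simps power2_eq_square)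
      finally show ?thesis .
    qed
    from first_order_euler_solution[OF assms(1,3) this] show ?thesis
      by (simp add: init)
  qed
  have u: "y * g' y - z1 * g y = \<alpha> * g' \<alpha> * (y / \<alpha>) powr z2"
    using ode by (rule factor)
  have v: "y * g' y - z2 * g y = \<alpha> * g' \<alpha> * (y / \<alpha>) powr z1"
    by (rule factor) (use ode in \<open>simp add: algebra_simps\<close>)
  show "(z1 - z2) * g y = \<alpha> * g' \<alpha> * ((y / \<alpha>) powr z1 - (y / \<alpha>) powr z2)"
    using u v by (simp add: algebra_simps)
  have pos: "y > 0" using assms by auto
  have "y * ((z1 - z2) * g' y) = z1 * (y * g' y - z2 * g y) - z2 * (y * g' y - z1 * g y)"
    by (simp add: algebra_simps)
  also have "\<dots> = \<alpha> * g' \<alpha> * (z1 * (y / \<alpha>) powr z1 - z2 * (y / \<alpha>) powr z2)"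
    unfolding u v by (simp add: algebra_simps)
  finally show "(z1 - z2) * g' y
      = g' \<alpha> * (z1 * (y / \<alpha>) powr (z1 - 1) - z2 * (y / \<alpha>) powr (z2 - 1))"
    using pos assms(1) by (simp add: powr_diff field_simps)
qed

section \<open>The homogeneous solution\<close>

theorem lemma2p2:
  fixes \<mu>\<^sub>A \<mu>\<^sub>L \<delta> \<sigma>\<^sub>A \<sigma>\<^sub>L \<rho> \<alpha>\<^sub>0 \<beta> \<zeta>\<^sub>1 \<zeta>\<^sub>2 :: real
  assumes "\<sigma>\<^sub>A > 0" and "\<sigma>\<^sub>L > 0" and "-1 < \<rho>" and "\<rho> < 1"
    and "\<delta> > \<mu>\<^sub>A" and "\<mu>\<^sub>A > \<mu>\<^sub>L" and "\<delta> > 0"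
    and "\<alpha>\<^sub>0 > 0" and "\<beta> > \<alpha>\<^sub>0"
    and "\<zeta>\<^sub>1 = zeta1 \<mu>\<^sub>A \<mu>\<^sub>L \<delta> (sigma_tilde2 \<sigma>\<^sub>A \<sigma>\<^sub>L \<rho>)"
    and "\<zeta>\<^sub>2 = zeta2 \<mu>\<^sub>A \<mu>\<^sub>L \<delta> (sigma_tilde2 \<sigma>\<^sub>A \<sigma>\<^sub>L \<rho>)"
  shows "\<zeta>\<^sub>1 < 0 \<and> \<zeta>\<^sub>2 > 1 \<and>
         is_homogeneous_solution \<mu>\<^sub>A \<mu>\<^sub>L \<sigma>\<^sub>A \<sigma>\<^sub>L \<rho> \<delta> \<alpha>\<^sub>0 \<beta> (candidate \<zeta>\<^sub>1 \<zeta>\<^sub>2 \<alpha>\<^sub>0 \<beta>) \<and>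
         (\<forall>G. is_homogeneous_solution \<mu>\<^sub>A \<mu>\<^sub>L \<sigma>\<^sub>A \<sigma>\<^sub>L \<rho> \<delta> \<alpha>\<^sub>0 \<beta> G \<longrightarrow>
              (\<forall>x \<in> wedge \<alpha>\<^sub>0 \<beta>. G x = candidate \<zeta>\<^sub>1 \<zeta>\<^sub>2 \<alpha>\<^sub>0 \<beta> x))"
proof -
  let ?S = "wedge \<alpha>\<^sub>0 \<beta>"
  let ?I = "{\<alpha>\<^sub>0..\<beta>}"
  let ?C = "candidate \<zeta>\<^sub>1 \<zeta>\<^sub>2 \<alpha>\<^sub>0 \<beta>"
  define s2 where "s2 = sigma_tilde2 \<sigma>\<^sub>A \<sigma>\<^sub>L \<rho>"
  define p where "p = (\<lambda>\<zeta> y. (y / \<alpha>\<^sub>0) powr \<zeta>)"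
  define d where "d = \<zeta>\<^sub>1 * p (\<zeta>\<^sub>1 - 1) \<beta> - \<zeta>\<^sub>2 * p (\<zeta>\<^sub>2 - 1) \<beta>"
  note bounds = \<open>\<alpha>\<^sub>0 > 0\<close> \<open>\<beta> > \<alpha>\<^sub>0\<close>
  have s2: "s2 > 0"
  proof -
    have "s2 = (\<sigma>\<^sub>A - \<sigma>\<^sub>L)\<^sup>2 + 2 * (1 - \<rho>) * (\<sigma>\<^sub>A * \<sigma>\<^sub>L)"
      by (simp add: s2_def sigma_tilde2_def power2_eq_square algebra_simps)
    moreover have "2 * (1 - \<rho>) * (\<sigma>\<^sub>A * \<sigma>\<^sub>L) > 0" using assms by simp
    ultimately show ?thesis by (smt (verit) zero_le_power2)
  qed
  have "\<mu>\<^sub>L < \<delta>" using assms by simp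
  note roots = characteristic_roots[OF s2 \<open>\<delta> > \<mu>\<^sub>A\<close> this,
      folded assms(10)[folded s2_def] assms(11)[folded s2_def]]
  (* By Vieta, the reduced equation is s2 / 2 times the Euler equation with roots \<zeta>\<^sub>1 and \<zeta>\<^sub>2;
     a, b, c stand for the second derivative, the first derivative and the value. *)
  have euler: "1 / 2 * s2 * y\<^sup>2 * a + (\<mu>\<^sub>A - \<mu>\<^sub>L) * y * b + \<mu>\<^sub>L * c - \<delta> * c
      = s2 / 2 * (y\<^sup>2 * a + (1 - \<zeta>\<^sub>1 - \<zeta>\<^sub>2) * y * b + \<zeta>\<^sub>1 * \<zeta>\<^sub>2 * c)" for y a b c
  proof -
    have "s2 / 2 * (y\<^sup>2 * a + (1 - \<zeta>\<^sub>1 - \<zeta>\<^sub>2) * y * b + \<zeta>\<^sub>1 * \<zeta>\<^sub>2 * c)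
        = s2 / 2 * y\<^sup>2 * a + (s2 - s2 * (\<zeta>\<^sub>1 + \<zeta>\<^sub>2)) / 2 * y * b + s2 * (\<zeta>\<^sub>1 * \<zeta>\<^sub>2) / 2 * c"
      by (simp add: field_simps)
    then show ?thesis unfolding roots(3,4) by (simp add: field_simps)
  qed
  have pow_pos: "p \<zeta> \<beta> > 0" for \<zeta> using bounds by (simp add: p_def)
  (* Both summands of d are negative, since \<zeta>\<^sub>1 < 0 < \<zeta>\<^sub>2. *)
  have d: "d < 0"
    unfolding d_def using roots(1,2) pow_pos[of "\<zeta>\<^sub>1 - 1"] pow_pos[of "\<zeta>\<^sub>2 - 1"]
    by (smt (verit) mult_neg_pos mult_pos_pos)
  have dp: "(p \<zeta> has_real_derivative \<zeta> / \<alpha>\<^sub>0 * p (\<zeta> - 1) y) (at y within ?I)"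
    if "y \<in> ?I" for \<zeta> y
  proof -
    have pos: "y / \<alpha>\<^sub>0 > 0" using that bounds by auto
    have "((\<lambda>y. y / \<alpha>\<^sub>0) has_real_derivative 1 / \<alpha>\<^sub>0) (at y within ?I)"
      using bounds by (auto intro!: derivative_eq_intros)
    from DERIV_chain2[OF has_real_derivative_powr[OF pos] this]
    show ?thesis by (simp add: p_def)
  qed
  have cont_p: "continuous_on ?I (p \<zeta>)" for \<zeta>
    using dp by (rule DERIV_continuous_on)

  define g where "g = (\<lambda>y. \<alpha>\<^sub>0 / d * (p \<zeta>\<^sub>1 y - p \<zeta>\<^sub>2 y))"
  define g' where "g' = (\<lambda>y. (\<zeta>\<^sub>1 * p (\<zeta>\<^sub>1 - 1) y - \<zeta>\<^sub>2 * p (\<zeta>\<^sub>2 - 1) y) / d)"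
  define g'' where "g'' = (\<lambda>y. (\<zeta>\<^sub>1 * (\<zeta>\<^sub>1 - 1) * p (\<zeta>\<^sub>1 - 2) y
      - \<zeta>\<^sub>2 * (\<zeta>\<^sub>2 - 1) * p (\<zeta>\<^sub>2 - 2) y) / (\<alpha>\<^sub>0 * d))"
  have C: "?C (x1, x2) = x2 * g (x1 / x2)" for x1 x2
    by (simp add: candidate_def g_def p_def d_def)
  have prof: "has_profile \<alpha>\<^sub>0 \<beta> 1 g ?C" by (simp add: has_profile_def C)
  have deriv: "(g has_real_derivative g' y) (at y within ?I)" if "y \<in> ?I" for y
    unfolding g_def using bounds d
    by (auto intro!: derivative_eq_intros dp[OF that] simp: g'_def field_simps)
  have deriv2: "(g' has_real_derivative g'' y) (at y within ?I)" if "y \<in> ?I" for y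
    unfolding g'_def using bounds d
    by (auto intro!: derivative_eq_intros dp[OF that] simp: g''_def field_simps)
  have cont: "continuous_on ?I g''"
    unfolding g''_def using bounds d by (intro continuous_intros cont_p) auto
  have ode: "y\<^sup>2 * g'' y + (1 - \<zeta>\<^sub>1 - \<zeta>\<^sub>2) * y * g' y + \<zeta>\<^sub>1 * \<zeta>\<^sub>2 * g y = 0" if "y \<in> ?I" for y
  proof -
    have "y > 0" using that bounds by auto
    then have "p (\<zeta> - 1) y = \<alpha>\<^sub>0 * p \<zeta> y / y" "p (\<zeta> - 2) y = \<alpha>\<^sub>0\<^sup>2 * p \<zeta> y / y\<^sup>2" for \<zeta>
      using bounds by (simp_all add: p_def powr_diff power_divide)
    then show ?thesis
      using d bounds \<open>y > 0\<close> unfolding g''_def g'_def g_def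
      by (simp add: field_simps power2_eq_square)
  qed
  have g'_\<beta>: "g' \<beta> = 1" using d by (simp add: g'_def d_def)
  have g_\<alpha>: "g \<alpha>\<^sub>0 = 0" using bounds by (simp add: g_def p_def)
  (* At the right end of a slice, the derivative within the wedge is the left derivative of the
     boundary condition, so that condition says that the profile has derivative 1 at \<beta>. *)
  have left: "at (\<beta> * x2) within {t. (t, x2) \<in> ?S} = at_left (\<beta> * x2)" if "x2 > 0" for x2
    using bounds that by (simp add: horizontal_slice_wedge at_within_Icc_at_left)
  have right_end: "(\<beta> * x2, x2) \<in> ?S" if "x2 > 0" for x2
    using bounds that by (simp add: mem_wedge_iff)

  have "is_homogeneous_solution \<mu>\<^sub>A \<mu>\<^sub>L \<sigma>\<^sub>A \<sigma>\<^sub>L \<rho> \<delta> \<alpha>\<^sub>0 \<beta> ?C"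
    unfolding is_homogeneous_solution_def
  proof (intro conjI)
    show "C2_on ?S ?C" by (rule C2_on_degree1_profile[OF bounds prof deriv deriv2 cont])
    show "homogeneous1_on ?S ?C" by (auto simp: homogeneous1_on_def C)
    show "\<forall>x\<in>?S. generator \<mu>\<^sub>A \<mu>\<^sub>L \<sigma>\<^sub>A \<sigma>\<^sub>L \<rho> ?S ?C x - \<delta> * ?C x = 0"
    proof clarify
      fix x1 x2 assume x: "(x1, x2) \<in> ?S"
      let ?y = "x1 / x2"
      have y: "?y \<in> ?I" using x by (simp add: mem_wedge_iff)
      have "generator \<mu>\<^sub>A \<mu>\<^sub>L \<sigma>\<^sub>A \<sigma>\<^sub>L \<rho> ?S ?C (x1, x2) - \<delta> * ?C (x1, x2)
          = x2 * (1 / 2 * s2 * ?y\<^sup>2 * g'' ?y + (\<mu>\<^sub>A - \<mu>\<^sub>L) * ?y * g' ?y + \<mu>\<^sub>L * g ?y - \<delta> * g ?y)"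
        using generator_degree1_profile[OF bounds prof deriv deriv2 x refl]
        unfolding C s2_def by (simp add: right_diff_distrib)
      also have "\<dots> = 0" unfolding euler ode[OF y] by simp
      finally show "generator \<mu>\<^sub>A \<mu>\<^sub>L \<sigma>\<^sub>A \<sigma>\<^sub>L \<rho> ?S ?C (x1, x2) - \<delta> * ?C (x1, x2) = 0" .
    qed
    show "\<forall>x2>0. ?C (\<alpha>\<^sub>0 * x2, x2) = 0" using g_\<alpha> by (simp add: C)
    show "\<forall>x2>0. ((\<lambda>x1. ?C (x1, x2)) has_real_derivative 1) (at_left (\<beta> * x2))"
      using has_profile_horizontal_derivative[OF bounds prof deriv right_end] left g'_\<beta> by simp
  qed
  moreover have "G x = ?C x"
    if sol: "is_homogeneous_solution \<mu>\<^sub>A \<mu>\<^sub>L \<sigma>\<^sub>A \<sigma>\<^sub>L \<rho> \<delta> \<alpha>\<^sub>0 \<beta> G" and x: "x \<in> ?S" for G x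
  proof -
    have C2: "C2_on ?S G" and hom: "homogeneous1_on ?S G"
      and pde: "\<And>x. x \<in> ?S \<Longrightarrow> generator \<mu>\<^sub>A \<mu>\<^sub>L \<sigma>\<^sub>A \<sigma>\<^sub>L \<rho> ?S G x - \<delta> * G x = 0"
      and bc1: "\<And>x2. x2 > 0 \<Longrightarrow> G (\<alpha>\<^sub>0 * x2, x2) = 0"
      and bc2: "\<And>x2. x2 > 0 \<Longrightarrow> ((\<lambda>x1. G (x1, x2)) has_real_derivative 1) (at_left (\<beta> * x2))"
      using sol unfolding is_homogeneous_solution_def by blast+
    obtain h h' h'' where prof_h: "has_profile \<alpha>\<^sub>0 \<beta> 1 h G"
      and h: "\<And>y. y \<in> ?I \<Longrightarrow> (h has_real_derivative h' y) (at y within ?I)"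
      and h': "\<And>y. y \<in> ?I \<Longrightarrow> (h' has_real_derivative h'' y) (at y within ?I)"
      using C2_homogeneous_has_profile[OF bounds C2 hom] by metis
    have ode_h: "y\<^sup>2 * h'' y + (1 - \<zeta>\<^sub>1 - \<zeta>\<^sub>2) * y * h' y + \<zeta>\<^sub>1 * \<zeta>\<^sub>2 * h y = 0"
      if y: "y \<in> ?I" for y
    proof -
      have y1: "(y, 1) \<in> ?S" using y bounds by (simp add: mem_wedge_iff)
      have "1 / 2 * s2 * y\<^sup>2 * h'' y + (\<mu>\<^sub>A - \<mu>\<^sub>L) * y * h' y + \<mu>\<^sub>L * h y - \<delta> * h y = 0"
        using pde[OF y1] generator_degree1_profile[OF bounds prof_h h h' y1, of y]
          has_profileD[OF prof_h y1] by (simp add: s2_def)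
      then show ?thesis unfolding euler using s2 by simp
    qed
    have "(\<alpha>\<^sub>0, 1) \<in> ?S" using bounds by (simp add: mem_wedge_iff)
    then have h_\<alpha>: "h \<alpha>\<^sub>0 = 0" using bc1[of 1] has_profileD[OF prof_h] by fastforce
    have h'_\<beta>: "h' \<beta> = 1"
    proof -
      have "((\<lambda>t. G (t, 1)) has_real_derivative h' \<beta>) (at_left \<beta>)"
        using has_profile_horizontal_derivative[OF bounds prof_h h right_end[of 1]] left[of 1]
        by simp
      then show ?thesis
        using bc2[of 1] by (auto simp: has_real_derivative_iff_has_vector_derivative
            intro: vector_derivative_unique_within[of \<beta> "{..<\<beta>}"])
    qed
    have ne: "\<zeta>\<^sub>1 \<noteq> \<zeta>\<^sub>2" using roots(1,2) by simp
    note h_eq = euler_solution[OF bounds(1) ne _ h h' ode_h h_\<alpha>]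
    (* The boundary condition at \<beta> determines the one free parameter, the initial slope. *)
    have "\<zeta>\<^sub>1 - \<zeta>\<^sub>2 = h' \<alpha>\<^sub>0 * d"
      using h_eq(2)[of \<beta>] bounds h'_\<beta> by (simp add: d_def p_def)
    then have k: "h' \<alpha>\<^sub>0 = (\<zeta>\<^sub>1 - \<zeta>\<^sub>2) / d" using d by (simp add: field_simps)
    have h_g: "h y = g y" if "y \<in> ?I" for y
    proof -
      have "(\<zeta>\<^sub>1 - \<zeta>\<^sub>2) * h y = (\<zeta>\<^sub>1 - \<zeta>\<^sub>2) * g y"
        using h_eq(1)[OF that] unfolding k by (simp add: g_def p_def)
      then show ?thesis using ne by simp
    qed
    obtain x1 x2 where x12: "x = (x1, x2)" by (cases x)
    then have "x1 / x2 \<in> ?I" using x by (simp add: mem_wedge_iff)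
    then show ?thesis
      using has_profileD[OF prof_h, of x1 x2] x by (simp add: x12 C h_g)
  qed
  ultimately show ?thesis using roots(1,2) by blast
qed

end
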